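(* Let $\beta$ be an $n$-strand braid which is not order-preserving. Then the precone search algorithm (described in the context) applied to $\beta$ terminates in finite time.
   Context: $F_n=\langle x_1,\dots,x_n\rangle$ is the free group of rank $n$, and $B_n$ is the $n$-strand braid group with Artin generators $\sigma_1,\dots,\sigma_{n-1}$. $B_n$ acts on $F_n$ on the left by automorphisms (braid words are read from right to left, so a product of braids acts as the composition of the corresponding automorphisms, rightmost first), where $\sigma_i$ acts by $x_i\mapsto x_{i+1}$, $x_{i+1}\mapsto x_{i+1}^{-1}x_ix_{i+1}$, and $x_j\mapsto x_j$ for $j\neq i,i+1$. We write $\beta(\cdot)$ for the action of $\beta$ on elements and subsets of $F_n$. A subset $P\subset F_n$ is a (conjugation-invariant) positive cone if (1) $P\cdot P\subset P$; (2) $F_n=P\sqcup P^{-1}\sqcup\{1\}$ (disjoint union); (3) $gPg^{-1}=P$ for all $g\in F_n$. A braid $\beta\in B_n$ is order-preserving if there is a positive cone $P$ of $F_n$ with $\beta(P)=P$. For $k\ge 1$ let $W_k\subset F_n$ be the set of reduced words in $x_1,\dots,x_n$ (and their inverses) of length at most $k$. A subset $P$ is a $k$-precone of $F_n$ if (1) $(P\cdot P)\cap W_k\subset P$; (2) $W_k=P\sqcup P^{-1}\sqcup\{1\}$; (3) $(gPg^{-1})\cap W_k\subset P$ for all $g\in W_k$. A $k$-precone $P_k$ is preserved by $\beta$ if $\beta(P_k)\cap W_k\subset P_k$. Precone search algorithm: the input is a braid $\beta$ on $n$ strands. For each positive integer $k$, starting with $k=1$, the algorithm builds all $k$-precones of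 $F_n$ that are preserved by $\beta$ (for each fixed $k$ this is a finite search among subsets of the finite set $W_k$). If no such $k$-precone exists, the algorithm terminates and returns a proof that $\beta$ is not order-preserving. If there exists at least one $k$-precone preserved by $\beta$, then $k$ is increased by one and the process repeats. *)

theory Defs
  imports "HOL-Algebra.Bij" "HOL-Algebra.Generated_Groups" "HOL-Library.While_Combinator"
begin

section \<open>Free groups as groups of reduced words\<close>

text \<open>The letter \<open>(a, True)\<close> stands for the generator \<open>a\<close>, the letter \<open>(a, False)\<close> for its inverse.\<close>

type_synonym 'a word = "('a \<times> bool) list"

definition inv_letter :: "'a \<times> bool \<Rightarrow> 'a \<times> bool" where
  "inv_letter x = (fst x, \<not> snd x)"

definition reduced :: "'a word \<Rightarrow> bool" where
  "reduced w \<longleftrightarrow> successively (\<lambda>x y. y \<noteq> inv_letter x) w"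

text \<open>\<open>push x w\<close> is the reduced form of \<open>x # w\<close>, for reduced \<open>w\<close>. Hence \<open>foldr push u v\<close> is
  the reduced form of \<open>u @ v\<close>, for reduced \<open>v\<close>.\<close>

fun push :: "'a \<times> bool \<Rightarrow> 'a word \<Rightarrow> 'a word" where
  "push x [] = [x]"
| "push x (y # w) = (if y = inv_letter x then w else x # y # w)"

definition free_group :: "'a set \<Rightarrow> 'a word monoid" where
  "free_group S = \<lparr>carrier = {w. reduced w \<and> fst ` set w \<subseteq> S}, mult = foldr push, one = []\<rparr>"

definition gen :: "'a \<Rightarrow> 'a word" where
  "gen a = [(a, True)]"

text \<open>The homomorphism from a free group to \<open>G\<close> that sends each generator \<open>a\<close> to \<open>f a\<close>.\<close>

definition free_lift :: "('b, 'c) monoid_scheme \<Rightarrow> ('a \<Rightarrow> 'b) \<Rightarrow> 'a word \<Rightarrow> 'b" where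
  "free_lift G f w =
     foldr (\<lambda>x g. (if snd x then f (fst x) else inv\<^bsub>G\<^esub> (f (fst x))) \<otimes>\<^bsub>G\<^esub> g) w \<one>\<^bsub>G\<^esub>"

definition normal_closure :: "('a, 'b) monoid_scheme \<Rightarrow> 'a set \<Rightarrow> 'a set" where
  "normal_closure G R = generate G (\<Union>g\<in>carrier G. (\<lambda>r. g \<otimes>\<^bsub>G\<^esub> r \<otimes>\<^bsub>G\<^esub> inv\<^bsub>G\<^esub> g) ` R)"

lemma inv_letter_simps [simp]:
  "inv_letter (a, e) = (a, \<not> e)" "inv_letter (inv_letter x) = x"
  "fst (inv_letter x) = fst x" "snd (inv_letter x) = (\<not> snd x)"
  by (simp_all add: inv_letter_def)

lemma reduced_simps [simp]:
  "reduced []" "reduced [x]" "reduced (x # y # w) \<longleftrightarrow> y \<noteq> inv_letter x \<and> reduced (y # w)"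
  by (simp_all add: reduced_def)

lemma reduced_ConsD: "reduced (x # w) \<Longrightarrow> reduced w"
  by (cases w) simp_all

lemma reduced_push: "reduced w \<Longrightarrow> reduced (push x w)"
  by (cases w) (auto dest: reduced_ConsD)

lemma reduced_foldr_push: "reduced v \<Longrightarrow> reduced (foldr push u v)"
  by (induction u) (simp_all add: reduced_push)

lemma push_reduced: "reduced (x # w) \<Longrightarrow> push x w = x # w"
  by (cases w) simp_all

lemma push_inv_push:
  assumes "reduced w"
  shows "push (inv_letter x) (push x w) = w"
proof (cases w)
  case Nil
  then show ?thesis by simp
next
  case (Cons y v)
  show ?thesis
  proof (cases "y = inv_letter x")
    case True
    with Cons assms show ?thesis by (cases v) auto
  next
    case False
    with Cons show ?thesis by simp
  qed
qed

lemma foldr_push_push: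
  assumes "reduced w"
  shows "foldr push (push x t) w = push x (foldr push t w)"
proof (cases t)
  case (Cons y s)
  have "push (inv_letter y) (push y (foldr push s w)) = foldr push s w"
    by (rule push_inv_push[OF reduced_foldr_push[OF assms]])
  moreover have "x = inv_letter y" if "y = inv_letter x"
    using that by simp
  ultimately show ?thesis using Cons by auto
qed simp

lemma foldr_push_assoc:
  "reduced w \<Longrightarrow> foldr push (foldr push u v) w = foldr push u (foldr push v w)"
  by (induction u) (simp_all add: foldr_push_push)

lemma foldr_push_Nil: "reduced w \<Longrightarrow> foldr push w [] = w"
proof (induction w)
  case (Cons x w)
  then show ?case using reduced_ConsD[OF Cons.prems] push_reduced[OF Cons.prems] by simp
qed simp

lemma set_push: "fst ` set (push x w) \<subseteq> insert (fst x) (fst ` set w)"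
  by (cases w) auto

lemma set_foldr_push: "fst ` set (foldr push u v) \<subseteq> fst ` set u \<union> fst ` set v"
proof (induction u)
  case (Cons x u)
  have "fst ` set (foldr push (x # u) v) \<subseteq> insert (fst x) (fst ` set (foldr push u v))"
    using set_push[of x "foldr push u v"] by simp
  also have "\<dots> \<subseteq> insert (fst x) (fst ` set u \<union> fst ` set v)"
    using Cons.IH by (rule insert_mono)
  finally show ?case by simp
qed simp

definition inv_word :: "'a word \<Rightarrow> 'a word" where
  "inv_word w = rev (map inv_letter w)"

lemma inv_word_left: "foldr push (inv_word w) w = []"
  by (induction w) (simp_all add: inv_word_def)

lemma reduced_inv_word: "reduced (inv_word w) \<longleftrightarrow> reduced w"
proof -
  have "x \<noteq> y \<longleftrightarrow> y \<noteq> x" for x y :: "'a \<times> bool" by blast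
  moreover have "(inv_letter x \<noteq> inv_letter (inv_letter y)) \<longleftrightarrow> (y \<noteq> inv_letter x)"
    for x y :: "'a \<times> bool" by auto
  ultimately show ?thesis
    by (simp add: reduced_def inv_word_def successively_map)
qed

lemma free_group_simps:
  "\<one>\<^bsub>free_group S\<^esub> = []" "u \<otimes>\<^bsub>free_group S\<^esub> v = foldr push u v"
  "w \<in> carrier (free_group S) \<longleftrightarrow> reduced w \<and> fst ` set w \<subseteq> S"
  by (simp_all add: free_group_def)

lemma inv_word_carrier: "inv_word w \<in> carrier (free_group S) \<longleftrightarrow> w \<in> carrier (free_group S)"
  unfolding free_group_simps reduced_inv_word by (simp add: inv_word_def image_image)

lemma group_free_group: "group (free_group S)"
proof (rule groupI)
  fix u v w
  assume "u \<in> carrier (free_group S)" "v \<in> carrier (free_group S)"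
  then show "u \<otimes>\<^bsub>free_group S\<^esub> v \<in> carrier (free_group S)"
    using subset_trans[OF set_foldr_push[of u v]] by (simp add: free_group_simps reduced_foldr_push)
next
  fix w
  assume "w \<in> carrier (free_group S)"
  then show "\<exists>v\<in>carrier (free_group S). v \<otimes>\<^bsub>free_group S\<^esub> w = \<one>\<^bsub>free_group S\<^esub>"
    by (intro bexI[of _ "inv_word w"]) (simp_all only: inv_word_carrier, simp add: free_group_simps inv_word_left)
qed (simp_all add: free_group_simps foldr_push_assoc)

lemma inv_free_group:
  "w \<in> carrier (free_group S) \<Longrightarrow> inv\<^bsub>free_group S\<^esub> w = inv_word w"
  by (rule group.inv_equality[OF group_free_group])
    (simp_all only: inv_word_carrier, simp add: free_group_simps inv_word_left)

lemma gen_carrier: "a \<in> S \<Longrightarrow> gen a \<in> carrier (free_group S)"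
  by (simp add: gen_def free_group_simps)

lemma free_lift_carrier:
  assumes "group G" "f \<in> S \<rightarrow> carrier G" "fst ` set w \<subseteq> S"
  shows "free_lift G f w \<in> carrier G"
proof -
  interpret group G by fact
  show ?thesis using assms(3)
  proof (induction w)
    case (Cons x w)
    then have "f (fst x) \<in> carrier G" using assms(2) by auto
    with Cons show ?case by (auto simp: free_lift_def)
  qed (simp add: free_lift_def)
qed

lemma free_lift_push:
  assumes "group G" "f \<in> S \<rightarrow> carrier G" "fst x \<in> S" "fst ` set w \<subseteq> S"
  shows "free_lift G f (push x w) = free_lift G f [x] \<otimes>\<^bsub>G\<^esub> free_lift G f w"
proof -
  interpret group G by fact
  have f: "f (fst x) \<in> carrier G" using assms by auto
  show ?thesis
  proof (cases w)
    case Nil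
    then show ?thesis using f by (simp add: free_lift_def)
  next
    case (Cons y v)
    have v: "free_lift G f v \<in> carrier G"
      using assms Cons by (intro free_lift_carrier[OF assms(1,2)]) auto
    have fy: "f (fst y) \<in> carrier G" using assms Cons by auto
    show ?thesis
    proof (cases "y = inv_letter x")
      case True
      with Cons f v show ?thesis
        by (simp add: free_lift_def m_assoc[symmetric])
    next
      case False
      with Cons f v fy show ?thesis by (simp add: free_lift_def)
    qed
  qed
qed

lemma free_lift_hom:
  assumes "group G" "f \<in> S \<rightarrow> carrier G"
  shows "free_lift G f \<in> hom (free_group S) G"
proof (rule homI)
  interpret group G by fact
  show "free_lift G f w \<in> carrier G" if "w \<in> carrier (free_group S)" for w
    using that by (intro free_lift_carrier[OF assms]) (auto simp: free_group_simps)
  fix u v assume "u \<in> carrier (free_group S)" "v \<in> carrier (free_group S)"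
  then have "fst ` set u \<subseteq> S" "fst ` set v \<subseteq> S" by (auto simp: free_group_simps)
  then have "free_lift G f (foldr push u v) = free_lift G f u \<otimes>\<^bsub>G\<^esub> free_lift G f v"
  proof (induction u)
    case Nil
    then show ?case using free_lift_carrier[OF assms, of v] by (simp add: free_lift_def)
  next
    case (Cons x u)
    have x: "fst x \<in> S" "fst ` set (foldr push u v) \<subseteq> S"
      using Cons.prems subset_trans[OF set_foldr_push[of u v]] by simp_all
    have c: "free_lift G f [x] \<in> carrier G" "free_lift G f u \<in> carrier G" "free_lift G f v \<in> carrier G"
      using Cons.prems by (auto intro!: free_lift_carrier[OF assms])
    have "free_lift G f (x # u) = free_lift G f [x] \<otimes>\<^bsub>G\<^esub> free_lift G f u"
    proof -
      have "f (fst x) \<in> carrier G" using assms(2) x by auto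
      then show ?thesis by (simp add: free_lift_def)
    qed
    with Cons c x show ?case by (simp add: free_lift_push[OF assms] m_assoc)
  qed
  then show "free_lift G f (u \<otimes>\<^bsub>free_group S\<^esub> v) = free_lift G f u \<otimes>\<^bsub>G\<^esub> free_lift G f v"
    by (simp add: free_group_simps)
qed

lemma free_lift_gen: "group G \<Longrightarrow> f a \<in> carrier G \<Longrightarrow> free_lift G f (gen a) = f a"
  by (simp add: free_lift_def gen_def group.is_monoid)

lemma free_group_hom_eqI:
  assumes "group G" "\<phi> \<in> hom (free_group S) G" "\<psi> \<in> hom (free_group S) G"
    and eq: "\<And>a. a \<in> S \<Longrightarrow> \<phi> (gen a) = \<psi> (gen a)"
    and "w \<in> carrier (free_group S)"
  shows "\<phi> w = \<psi> w"
proof -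
  interpret F: group "free_group S" by (rule group_free_group)
  interpret \<phi>: group_hom "free_group S" G \<phi>
    using assms by (simp add: group_hom_def group_hom_axioms_def group_free_group)
  interpret \<psi>: group_hom "free_group S" G \<psi>
    using assms by (simp add: group_hom_def group_hom_axioms_def group_free_group)
  have letter: "\<phi> [x] = \<psi> [x]" if "fst x \<in> S" for x
  proof (cases x)
    case (Pair a e)
    have "[(a, False)] = inv\<^bsub>free_group S\<^esub> (gen a)"
      using that Pair by (subst inv_free_group) (simp_all add: gen_carrier, simp add: gen_def inv_word_def)
    then show ?thesis
      using that Pair eq[of a] gen_carrier[of a S] by (cases e) (simp_all add: gen_def)
  qed
  show ?thesis using assms(5)
  proof (induction w)
    case Nil
    then show ?case using \<phi>.hom_one \<psi>.hom_one by (simp add: free_group_simps)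
  next
    case (Cons x w)
    then have w: "w \<in> carrier (free_group S)" and x: "[x] \<in> carrier (free_group S)"
      by (auto simp: free_group_simps dest: reduced_ConsD)
    have "x # w = [x] \<otimes>\<^bsub>free_group S\<^esub> w"
      using Cons.prems by (simp add: free_group_simps push_reduced)
    with Cons.IH w x letter[of x] show ?case by (simp add: free_group_simps(3))
  qed
qed

lemma normal_closure_normal:
  assumes "group G" "R \<subseteq> carrier G"
  shows "normal_closure G R \<lhd> G"
proof -
  interpret group G by fact
  show ?thesis unfolding normal_closure_def
  proof (rule normal_generateI)
    show "(\<Union>g\<in>carrier G. (\<lambda>r. g \<otimes>\<^bsub>G\<^esub> r \<otimes>\<^bsub>G\<^esub> inv\<^bsub>G\<^esub> g) ` R) \<subseteq> carrier G"
      using assms by auto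
    fix h g assume "h \<in> (\<Union>g\<in>carrier G. (\<lambda>r. g \<otimes>\<^bsub>G\<^esub> r \<otimes>\<^bsub>G\<^esub> inv\<^bsub>G\<^esub> g) ` R)" and g: "g \<in> carrier G"
    then obtain k r where kr: "k \<in> carrier G" "r \<in> R" "h = k \<otimes>\<^bsub>G\<^esub> r \<otimes>\<^bsub>G\<^esub> inv\<^bsub>G\<^esub> k" by auto
    then have "r \<in> carrier G" using assms by auto
    with kr g have "g \<otimes>\<^bsub>G\<^esub> h \<otimes>\<^bsub>G\<^esub> inv\<^bsub>G\<^esub> g = (g \<otimes>\<^bsub>G\<^esub> k) \<otimes>\<^bsub>G\<^esub> r \<otimes>\<^bsub>G\<^esub> inv\<^bsub>G\<^esub> (g \<otimes>\<^bsub>G\<^esub> k)"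
      by (simp add: m_assoc inv_mult_group)
    then show "g \<otimes>\<^bsub>G\<^esub> h \<otimes>\<^bsub>G\<^esub> inv\<^bsub>G\<^esub> g \<in> (\<Union>g\<in>carrier G. (\<lambda>r. g \<otimes>\<^bsub>G\<^esub> r \<otimes>\<^bsub>G\<^esub> inv\<^bsub>G\<^esub> g) ` R)"
      using kr g by blast
  qed
qed

lemma normal_closure_subset_kernel:
  assumes "group_hom G H h" "R \<subseteq> kernel G H h"
  shows "normal_closure G R \<subseteq> kernel G H h"
proof -
  interpret group_hom G H h by fact
  have "kernel G H h \<lhd> G" by (rule normal_kernel)
  then show ?thesis unfolding normal_closure_def
    using assms(2) by (intro G.generate_subgroup_incl)
      (auto dest: normal.inv_op_closed2 normal_imp_subgroup)
qed


section \<open>Braid groups and their action on free groups\<close>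

abbreviation Fn :: "nat \<Rightarrow> nat word monoid" where
  "Fn n \<equiv> free_group {1..n}"

definition artin_relators :: "nat \<Rightarrow> nat word set" where
  "artin_relators n =
     (let G = free_group {1..<n}; \<sigma> = gen in
       {(\<sigma> i \<otimes>\<^bsub>G\<^esub> \<sigma> j) \<otimes>\<^bsub>G\<^esub> inv\<^bsub>G\<^esub> (\<sigma> j \<otimes>\<^bsub>G\<^esub> \<sigma> i) | i j.
          i \<in> {1..<n} \<and> j \<in> {1..<n} \<and> i + 2 \<le> j} \<union>
       {(\<sigma> i \<otimes>\<^bsub>G\<^esub> \<sigma> (i+1) \<otimes>\<^bsub>G\<^esub> \<sigma> i) \<otimes>\<^bsub>G\<^esub> inv\<^bsub>G\<^esub> (\<sigma> (i+1) \<otimes>\<^bsub>G\<^esub> \<sigma> i \<otimes>\<^bsub>G\<^esub> \<sigma> (i+1)) | i.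
          i \<in> {1..<n} \<and> i + 1 \<in> {1..<n}})"

definition braid_group :: "nat \<Rightarrow> nat word set monoid" where
  "braid_group n = free_group {1..<n} Mod normal_closure (free_group {1..<n}) (artin_relators n)"

definition artin_image :: "nat \<Rightarrow> nat \<Rightarrow> nat \<Rightarrow> nat word" where
  "artin_image n i j =
     (if j = i then gen (i+1)
      else if j = i+1 then inv\<^bsub>Fn n\<^esub> gen (i+1) \<otimes>\<^bsub>Fn n\<^esub> gen i \<otimes>\<^bsub>Fn n\<^esub> gen (i+1)
      else gen j)"

text \<open>The restriction to the carrier makes this an element of \<^const>\<open>AutoGroup\<close>, whose elements
  are extensional functions. The multiplication of \<^const>\<open>AutoGroup\<close> is composition, the right
  factor being applied first.\<close>

definition artin_aut :: "nat \<Rightarrow> nat \<Rightarrow> nat word \<Rightarrow> nat word" where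
  "artin_aut n i = restrict (free_lift (Fn n) (artin_image n i)) (carrier (Fn n))"

text \<open>All words representing a braid act by the same automorphism; see \<open>braid_action_hom\<close> and
  \<open>braid_action_generator\<close> below.\<close>

definition braid_action :: "nat \<Rightarrow> nat word set \<Rightarrow> nat word \<Rightarrow> nat word" where
  "braid_action n \<beta> = the_elem (free_lift (AutoGroup (Fn n)) (artin_aut n) ` \<beta>)"

context
  notes One_nat_def [simp del]
begin

lemma artin_aut_eval:
  "w \<in> carrier (Fn n) \<Longrightarrow> artin_aut n i w = free_lift (Fn n) (artin_image n i) w"
  by (simp add: artin_aut_def)

context
  fixes n i :: nat
  assumes i: "i \<in> {1..<n}"
begin

lemma artin_image_simps:
  "artin_image n i i = [(Suc i, True)]"
  "artin_image n i (Suc i) = [(Suc i, False), (i, True), (Suc i, True)]"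
  "j \<noteq> i \<Longrightarrow> j \<noteq> Suc i \<Longrightarrow> artin_image n i j = [(j, True)]"
  using i
  by (simp_all add: artin_image_def flip: Suc_eq_plus1)
    (simp_all add: inv_free_group gen_carrier free_group_simps gen_def
      inv_word_def)

lemma artin_image_carrier: "artin_image n i \<in> {1..n} \<rightarrow> carrier (Fn n)"
proof
  fix j assume "j \<in> {1..n}"
  then show "artin_image n i j \<in> carrier (Fn n)"
    using i by (cases "j = i"; cases "j = Suc i") (auto simp: artin_image_simps free_group_simps)
qed

lemma artin_aut_hom: "artin_aut n i \<in> hom (Fn n) (Fn n)"
proof -
  have "free_lift (Fn n) (artin_image n i) \<in> hom (Fn n) (Fn n)"
    by (rule free_lift_hom[OF group_free_group artin_image_carrier])
  moreover have "v \<otimes>\<^bsub>Fn n\<^esub> w \<in> carrier (Fn n)"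
    if "v \<in> carrier (Fn n)" "w \<in> carrier (Fn n)" for v w
    using that by (rule monoid.m_closed[OF group.is_monoid[OF group_free_group]])
  ultimately show ?thesis by (simp add: hom_def artin_aut_def Pi_iff)
qed

lemma artin_aut_gen: "j \<in> {1..n} \<Longrightarrow> artin_aut n i (gen j) = artin_image n i j"
  using artin_image_carrier
  by (simp add: artin_aut_def gen_carrier free_lift_gen group_free_group Pi_iff)

lemma artin_aut_auto: "artin_aut n i \<in> auto (Fn n)"
proof -
  define g where "g j = (if j = i then [(i, True), (Suc i, True), (i, False)]
    else if j = Suc i then gen i else gen j)" for j
  have g: "g \<in> {1..n} \<rightarrow> carrier (Fn n)"
    using i by (auto simp: g_def gen_def free_group_simps)
  define \<psi> where "\<psi> = free_lift (Fn n) g"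
  have \<psi>: "\<psi> \<in> hom (Fn n) (Fn n)"
    unfolding \<psi>_def by (rule free_lift_hom[OF group_free_group g])
  have id: "(\<lambda>w. w) \<in> hom (Fn n) (Fn n)" by (simp add: hom_def)
  have 1: "\<psi> (artin_aut n i w) = w" if w: "w \<in> carrier (Fn n)" for w
  proof (rule free_group_hom_eqI[OF group_free_group _ id _ w])
    show "(\<lambda>w. \<psi> (artin_aut n i w)) \<in> hom (Fn n) (Fn n)"
      using hom_compose[OF artin_aut_hom \<psi>] by (simp add: comp_def)
    fix j assume j: "j \<in> {1..n}"
    show "\<psi> (artin_aut n i (gen j)) = gen j"
      using i j unfolding artin_aut_gen[OF j]
      by (cases "j = i"; cases "j = Suc i")
        (auto simp: artin_image_simps \<psi>_def free_lift_def g_def gen_def free_group_simps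
          inv_free_group inv_word_def)
  qed
  have 2: "artin_aut n i (\<psi> w) = w" if w: "w \<in> carrier (Fn n)" for w
  proof (rule free_group_hom_eqI[OF group_free_group _ id _ w])
    show "(\<lambda>w. artin_aut n i (\<psi> w)) \<in> hom (Fn n) (Fn n)"
      using hom_compose[OF \<psi> artin_aut_hom] by (simp add: comp_def)
    fix j assume j: "j \<in> {1..n}"
    have "\<psi> (gen j) = g j"
      unfolding \<psi>_def using g j by (intro free_lift_gen[OF group_free_group]) auto
    moreover have "g j \<in> carrier (Fn n)" using g j by auto
    ultimately show "artin_aut n i (\<psi> (gen j)) = gen j"
      using i j
      by (cases "j = i"; cases "j = Suc i")
        (auto simp: artin_aut_eval artin_image_simps free_lift_def g_def gen_def free_group_simps
          inv_free_group inv_word_def)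
  qed
  have "bij_betw (artin_aut n i) (carrier (Fn n)) (carrier (Fn n))"
    using 1 2 artin_aut_hom \<psi>
    by (intro bij_betw_byWitness[where f' = \<psi>]) (auto simp: hom_def)
  then show ?thesis
    using artin_aut_hom by (simp add: auto_def Bij_def artin_aut_def)
qed

end

lemma AutoGroup_simps:
  "carrier (AutoGroup G) = auto G"
  "f \<in> auto G \<Longrightarrow> g \<in> auto G \<Longrightarrow> f \<otimes>\<^bsub>AutoGroup G\<^esub> g = compose (carrier G) f g"
  "\<one>\<^bsub>AutoGroup G\<^esub> = (\<lambda>x\<in>carrier G. x)"
  by (simp_all add: AutoGroup_def BijGroup_def auto_def)

lemma auto_Fn_eqI:
  assumes "\<phi> \<in> auto (Fn n)" "\<psi> \<in> auto (Fn n)"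
    and "\<And>j. j \<in> {1..n} \<Longrightarrow> \<phi> (gen j) = \<psi> (gen j)"
  shows "\<phi> = \<psi>"
proof (rule extensionalityI)
  show "\<phi> \<in> extensional (carrier (Fn n))" "\<psi> \<in> extensional (carrier (Fn n))"
    using assms by (auto simp: auto_def Bij_def)
  have h: "\<phi> \<in> hom (Fn n) (Fn n)" "\<psi> \<in> hom (Fn n) (Fn n)"
    using assms by (auto simp: auto_def)
  show "\<phi> w = \<psi> w" if "w \<in> carrier (Fn n)" for w
    by (rule free_group_hom_eqI[OF group_free_group h assms(3) that])
qed

lemma artin_aut_far:
  assumes "i \<in> {1..<n}" "j \<in> {1..<n}" "i + 2 \<le> j"
  shows "artin_aut n i \<otimes>\<^bsub>AutoGroup (Fn n)\<^esub> artin_aut n j =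
    artin_aut n j \<otimes>\<^bsub>AutoGroup (Fn n)\<^esub> artin_aut n i" (is "?l = ?r")
proof (rule auto_Fn_eqI)
  interpret A: group "AutoGroup (Fn n)" by (rule group.AutoGroup[OF group_free_group])
  have a: "artin_aut n i \<in> auto (Fn n)" "artin_aut n j \<in> auto (Fn n)"
    using assms by (auto intro: artin_aut_auto)
  show "?l \<in> auto (Fn n)" "?r \<in> auto (Fn n)"
    using a A.m_closed unfolding AutoGroup_simps(1) by auto
  fix k assume k: "k \<in> {1..n}"
  have c: "artin_image n i k \<in> carrier (Fn n)" "artin_image n j k \<in> carrier (Fn n)"
    using k assms artin_image_carrier by blast+
  have "artin_aut n i (artin_image n j k) = artin_aut n j (artin_image n i k)"
    using assms k c
    by (cases "k = i"; cases "k = Suc i"; cases "k = j"; cases "k = Suc j")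
      (auto simp: artin_aut_eval artin_image_simps free_lift_def free_group_simps
        inv_free_group inv_word_def)
  then show "?l (gen k) = ?r (gen k)"
    using a k assms by (simp add: AutoGroup_simps compose_eq gen_carrier artin_aut_gen)
qed

lemma artin_aut_braid:
  assumes "i \<in> {1..<n}" "i + 1 \<in> {1..<n}"
  shows "artin_aut n i \<otimes>\<^bsub>AutoGroup (Fn n)\<^esub> artin_aut n (i+1) \<otimes>\<^bsub>AutoGroup (Fn n)\<^esub> artin_aut n i =
    artin_aut n (i+1) \<otimes>\<^bsub>AutoGroup (Fn n)\<^esub> artin_aut n i \<otimes>\<^bsub>AutoGroup (Fn n)\<^esub> artin_aut n (i+1)"
    (is "?l = ?r")
proof (rule auto_Fn_eqI)
  interpret A: group "AutoGroup (Fn n)" by (rule group.AutoGroup[OF group_free_group])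
  define j where "j = Suc i"
  have j: "j \<in> {1..<n}" "i + 1 = j" using assms by (auto simp: j_def)
  have a: "artin_aut n i \<in> auto (Fn n)" "artin_aut n j \<in> auto (Fn n)"
    using assms j by (auto intro: artin_aut_auto)
  have ab: "artin_aut n i \<otimes>\<^bsub>AutoGroup (Fn n)\<^esub> artin_aut n j \<in> auto (Fn n)"
    "artin_aut n j \<otimes>\<^bsub>AutoGroup (Fn n)\<^esub> artin_aut n i \<in> auto (Fn n)"
    using a A.m_closed unfolding AutoGroup_simps(1) by auto
  show "?l \<in> auto (Fn n)" "?r \<in> auto (Fn n)"
    using a ab A.m_closed unfolding AutoGroup_simps(1) j by auto
  fix k assume k: "k \<in> {1..n}"
  have c: "artin_image n i k \<in> carrier (Fn n)" "artin_image n j k \<in> carrier (Fn n)"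
    using k assms j artin_image_carrier by blast+
  have cc: "artin_aut n i w \<in> carrier (Fn n)" "artin_aut n j w \<in> carrier (Fn n)"
    if "w \<in> carrier (Fn n)" for w
    using a that by (auto simp: auto_def hom_def)
  have im: "artin_image n j k = (if k = Suc i then [(Suc (Suc i), True)]
      else if k = Suc (Suc i) then [(Suc (Suc i), False), (Suc i, True), (Suc (Suc i), True)]
      else [(k, True)])" for k
    using artin_image_simps[OF j(1)] by (simp add: j_def)
  have im': "artin_image n i k = (if k = i then [(Suc i, True)]
      else if k = Suc i then [(Suc i, False), (i, True), (Suc i, True)]
      else [(k, True)])" for k
    using artin_image_simps[OF assms(1)] by simp
  have "artin_aut n i (artin_aut n j (artin_image n i k)) =
      artin_aut n j (artin_aut n i (artin_image n j k))"
    using assms k c cc(1)[OF c(2)] cc(2)[OF c(1)]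
    by (cases "k = i"; cases "k = Suc i"; cases "k = Suc (Suc i)")
      (simp_all add: artin_aut_eval im im' free_lift_def free_group_simps inv_free_group inv_word_def)
  then show "?l (gen k) = ?r (gen k)"
    using a ab k assms j c
    by (simp add: AutoGroup_simps compose_eq gen_carrier artin_aut_gen)
qed

lemma artin_relators_carrier: "artin_relators n \<subseteq> carrier (free_group {1..<n})"
proof -
  interpret group "free_group {1..<n}" by (rule group_free_group)
  show ?thesis
    unfolding artin_relators_def Let_def
    by (auto intro!: m_closed inv_closed gen_carrier)
qed

lemma braid_word_hom:
  "group_hom (free_group {1..<n}) (AutoGroup (Fn n)) (free_lift (AutoGroup (Fn n)) (artin_aut n))"
proof -
  have A: "group (AutoGroup (Fn n))" by (rule group.AutoGroup[OF group_free_group])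
  show ?thesis
    using free_lift_hom[OF A, of "artin_aut n" "{1..<n}"]
    by (auto simp: group_hom_def group_hom_axioms_def group_free_group A AutoGroup_simps
        artin_aut_auto)
qed

lemma artin_relators_kernel:
  "artin_relators n \<subseteq> kernel (free_group {1..<n}) (AutoGroup (Fn n))
     (free_lift (AutoGroup (Fn n)) (artin_aut n))" (is "_ \<subseteq> kernel ?G ?A ?h")
proof
  interpret group_hom ?G ?A ?h by (rule braid_word_hom)
  have g: "gen i \<in> carrier ?G" "?h (gen i) = artin_aut n i" if "i \<in> {1..<n}" for i
    using that by (auto simp: gen_carrier AutoGroup_simps artin_aut_auto intro!: free_lift_gen)
  have ker: "u \<otimes>\<^bsub>?G\<^esub> inv\<^bsub>?G\<^esub> v \<in> kernel ?G ?A ?h"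
    if "u \<in> carrier ?G" "v \<in> carrier ?G" "?h u = ?h v" for u v
    using that by (simp add: kernel_def)
  fix r assume "r \<in> artin_relators n"
  then consider (far) i j where "i \<in> {1..<n}" "j \<in> {1..<n}" "i + 2 \<le> j"
      "r = (gen i \<otimes>\<^bsub>?G\<^esub> gen j) \<otimes>\<^bsub>?G\<^esub> inv\<^bsub>?G\<^esub> (gen j \<otimes>\<^bsub>?G\<^esub> gen i)"
    | (braid) i where "i \<in> {1..<n}" "i + 1 \<in> {1..<n}"
      "r = (gen i \<otimes>\<^bsub>?G\<^esub> gen (i+1) \<otimes>\<^bsub>?G\<^esub> gen i) \<otimes>\<^bsub>?G\<^esub>
        inv\<^bsub>?G\<^esub> (gen (i+1) \<otimes>\<^bsub>?G\<^esub> gen i \<otimes>\<^bsub>?G\<^esub> gen (i+1))"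
    unfolding artin_relators_def Let_def by blast
  then show "r \<in> kernel ?G ?A ?h"
  proof cases
    case far
    show ?thesis
      unfolding far(4) using far(1-3) g artin_aut_far[OF far(1-3)] by (intro ker) simp_all
  next
    case braid
    show ?thesis
      unfolding braid(3)
    proof (rule ker)
      note gs = g[OF braid(1)] g[OF braid(2)]
      show "gen i \<otimes>\<^bsub>?G\<^esub> gen (i+1) \<otimes>\<^bsub>?G\<^esub> gen i \<in> carrier ?G"
        "gen (i+1) \<otimes>\<^bsub>?G\<^esub> gen i \<otimes>\<^bsub>?G\<^esub> gen (i+1) \<in> carrier ?G"
        by (intro G.m_closed gs)+
      show "?h (gen i \<otimes>\<^bsub>?G\<^esub> gen (i+1) \<otimes>\<^bsub>?G\<^esub> gen i) = ?h (gen (i+1) \<otimes>\<^bsub>?G\<^esub> gen i \<otimes>\<^bsub>?G\<^esub> gen (i+1))"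
        using artin_aut_braid[OF braid(1,2)] gs by (simp only: hom_mult G.m_closed)
    qed
  qed
qed

lemma artin_normal_closure_normal:
  "normal_closure (free_group {1..<n}) (artin_relators n) \<lhd> free_group {1..<n}"
  by (rule normal_closure_normal[OF group_free_group artin_relators_carrier])

lemma group_braid_group: "group (braid_group n)"
  unfolding braid_group_def by (rule normal.factorgroup_is_group[OF artin_normal_closure_normal])

lemma braid_action_coset:
  assumes "w \<in> carrier (free_group {1..<n})"
  shows "braid_action n (normal_closure (free_group {1..<n}) (artin_relators n) #>\<^bsub>free_group {1..<n}\<^esub> w) =
    free_lift (AutoGroup (Fn n)) (artin_aut n) w"
proof -
  let ?G = "free_group {1..<n}" and ?A = "AutoGroup (Fn n)"
  let ?h = "free_lift (AutoGroup (Fn n)) (artin_aut n)"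
  let ?N = "normal_closure ?G (artin_relators n)"
  interpret group_hom ?G ?A ?h by (rule braid_word_hom)
  interpret N: normal ?N ?G by (rule artin_normal_closure_normal)
  have k: "?N \<subseteq> kernel ?G ?A ?h"
    by (rule normal_closure_subset_kernel[OF braid_word_hom artin_relators_kernel])
  have "?h v = ?h w" if "v \<in> ?N #>\<^bsub>?G\<^esub> w" for v
  proof -
    obtain u where "u \<in> ?N" "v = u \<otimes>\<^bsub>?G\<^esub> w" using \<open>v \<in> ?N #>\<^bsub>?G\<^esub> w\<close> by (auto simp: r_coset_def)
    with k assms show ?thesis by (auto simp: kernel_def)
  qed
  moreover have "w \<in> ?N #>\<^bsub>?G\<^esub> w" by (rule G.rcos_self[OF assms N.subgroup_axioms])
  ultimately have "?h ` (?N #>\<^bsub>?G\<^esub> w) = {?h w}" by blast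
  then show ?thesis by (simp add: braid_action_def)
qed

theorem braid_action_hom: "braid_action n \<in> hom (braid_group n) (AutoGroup (Fn n))"
proof (rule homI)
  let ?G = "free_group {1..<n}"
  let ?N = "normal_closure ?G (artin_relators n)"
  interpret group_hom ?G "AutoGroup (Fn n)" "free_lift (AutoGroup (Fn n)) (artin_aut n)"
    by (rule braid_word_hom)
  interpret N: normal ?N ?G by (rule artin_normal_closure_normal)
  have ex: "\<exists>w\<in>carrier ?G. \<beta> = ?N #>\<^bsub>?G\<^esub> w" if "\<beta> \<in> carrier (braid_group n)" for \<beta>
    using that by (auto simp: braid_group_def FactGroup_def RCOSETS_def)
  fix \<beta> \<gamma> assume "\<beta> \<in> carrier (braid_group n)"
  then obtain v where v: "v \<in> carrier ?G" "\<beta> = ?N #>\<^bsub>?G\<^esub> v" using ex by blast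
  show "braid_action n \<beta> \<in> carrier (AutoGroup (Fn n))"
    unfolding v(2) braid_action_coset[OF v(1)] using v(1) by simp
  assume "\<gamma> \<in> carrier (braid_group n)"
  then obtain w where w: "w \<in> carrier ?G" "\<gamma> = ?N #>\<^bsub>?G\<^esub> w" using ex by blast
  have "\<beta> \<otimes>\<^bsub>braid_group n\<^esub> \<gamma> = ?N #>\<^bsub>?G\<^esub> (v \<otimes>\<^bsub>?G\<^esub> w)"
    unfolding v(2) w(2) using v(1) w(1) by (simp add: braid_group_def FactGroup_def N.rcos_sum)
  then show "braid_action n (\<beta> \<otimes>\<^bsub>braid_group n\<^esub> \<gamma>) =
      braid_action n \<beta> \<otimes>\<^bsub>AutoGroup (Fn n)\<^esub> braid_action n \<gamma>"
    using v w by (simp add: braid_action_coset)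
qed

theorem braid_action_generator:
  assumes "i \<in> {1..<n}"
  shows "braid_action n (normal_closure (free_group {1..<n}) (artin_relators n)
    #>\<^bsub>free_group {1..<n}\<^esub> gen i) = artin_aut n i"
proof -
  have "artin_aut n i \<in> carrier (AutoGroup (Fn n))"
    using assms by (simp add: AutoGroup_simps artin_aut_auto)
  then have "free_lift (AutoGroup (Fn n)) (artin_aut n) (gen i) = artin_aut n i"
    by (rule free_lift_gen[OF group.AutoGroup[OF group_free_group]])
  then show ?thesis using assms by (simp only: braid_action_coset gen_carrier)
qed

end


section \<open>Positive cones, precones and the precone search\<close>

definition positive_cone :: "nat \<Rightarrow> nat word set \<Rightarrow> bool" where
  "positive_cone n P \<longleftrightarrow>
     P <#>\<^bsub>Fn n\<^esub> P \<subseteq> P \<and>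
     carrier (Fn n) = P \<union> set_inv\<^bsub>Fn n\<^esub> P \<union> {\<one>\<^bsub>Fn n\<^esub>} \<and>
     P \<inter> set_inv\<^bsub>Fn n\<^esub> P = {} \<and> \<one>\<^bsub>Fn n\<^esub> \<notin> P \<and> \<one>\<^bsub>Fn n\<^esub> \<notin> set_inv\<^bsub>Fn n\<^esub> P \<and>
     (\<forall>g\<in>carrier (Fn n). g <#\<^bsub>Fn n\<^esub> P #>\<^bsub>Fn n\<^esub> inv\<^bsub>Fn n\<^esub> g = P)"

definition order_preserving :: "nat \<Rightarrow> nat word set \<Rightarrow> bool" where
  "order_preserving n \<beta> \<longleftrightarrow> (\<exists>P. positive_cone n P \<and> braid_action n \<beta> ` P = P)"

definition W :: "nat \<Rightarrow> nat \<Rightarrow> nat word set" where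
  "W n k = {w \<in> carrier (Fn n). length w \<le> k}"

definition precone :: "nat \<Rightarrow> nat \<Rightarrow> nat word set \<Rightarrow> bool" where
  "precone n k P \<longleftrightarrow>
     (P <#>\<^bsub>Fn n\<^esub> P) \<inter> W n k \<subseteq> P \<and>
     W n k = P \<union> set_inv\<^bsub>Fn n\<^esub> P \<union> {\<one>\<^bsub>Fn n\<^esub>} \<and>
     P \<inter> set_inv\<^bsub>Fn n\<^esub> P = {} \<and> \<one>\<^bsub>Fn n\<^esub> \<notin> P \<and> \<one>\<^bsub>Fn n\<^esub> \<notin> set_inv\<^bsub>Fn n\<^esub> P \<and>
     (\<forall>g\<in>W n k. (g <#\<^bsub>Fn n\<^esub> P #>\<^bsub>Fn n\<^esub> inv\<^bsub>Fn n\<^esub> g) \<inter> W n k \<subseteq> P)"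

definition preserved :: "nat \<Rightarrow> nat word set \<Rightarrow> nat \<Rightarrow> nat word set \<Rightarrow> bool" where
  "preserved n \<beta> k P \<longleftrightarrow> braid_action n \<beta> ` P \<inter> W n k \<subseteq> P"

definition preserved_precones :: "nat \<Rightarrow> nat word set \<Rightarrow> nat \<Rightarrow> nat word set set" where
  "preserved_precones n \<beta> k = {P \<in> Pow (W n k). precone n k P \<and> preserved n \<beta> k P}"

text \<open>The state of the search is the current \<open>k\<close> together with all \<open>k\<close>-precones preserved by
  \<open>\<beta>\<close>. A result \<open>Some (k, {})\<close> means that the search stops at stage \<open>k\<close>, the certificate that
  \<open>\<beta>\<close> is not order-preserving being that there are no such \<open>k\<close>-precones; \<open>None\<close> means that
  the search runs forever. Stage \<open>k\<close> is a search through the subsets of \<open>W n k\<close>; termination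
  in finite time means a result \<open>Some (k, {})\<close> with finite search spaces at the stages up to \<open>k\<close>.\<close>

definition precone_search ::
  "nat \<Rightarrow> nat word set \<Rightarrow> (nat \<times> nat word set set) option" where
  "precone_search n \<beta> =
     while_option (\<lambda>(k, Ps). Ps \<noteq> {}) (\<lambda>(k, Ps). (k + 1, preserved_precones n \<beta> (k + 1)))
       (1, preserved_precones n \<beta> 1)"

end

theory Submission
  imports Defs
begin

text \<open>If the search never stops, choose a preserved \<open>m\<close>-precone \<open>R m\<close> for every \<open>m\<close>. As every
  ball \<open>W n k\<close> is finite, a compactness argument yields one set \<open>P\<close> which agrees on each ball
  \<open>W n k\<close> with some \<open>R m\<close>, \<open>m \<ge> k\<close>. Each axiom of an invariant positive cone involves only
  finitely many words at a time, so \<open>P\<close> inherits all of them.\<close>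

declare One_nat_def [simp del]

section \<open>Compactness along an increasing chain of finite sets\<close>

text \<open>Pigeonhole: the traces on \<open>V\<close> lie in the finite set \<open>Pow V\<close>,
  so one of them recurs for infinitely many indices in \<open>M\<close>.\<close>

lemma infinite_trace:
  fixes R :: "nat \<Rightarrow> 'a set"
  assumes "infinite M" "finite V"
  obtains Q where "Q \<subseteq> V" "infinite {m \<in> M. R m \<inter> V = Q}"
proof -
  have "\<exists>Q\<in>Pow V. infinite {m \<in> M. R m \<inter> V = Q}"
    using assms by (intro pigeonhole_infinite_rel) auto
  then show ?thesis using that by blast
qed

text \<open>A Koenig-type argument: traces on the successive \<open>V k\<close> are chosen so that
  each extends the previous one and recurs infinitely often; \<open>P\<close> is their union. The
  bound \<open>m \<ge> k\<close> ensures later that stage \<open>m\<close> covers the ball of radius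
  \<open>k\<close>.\<close>

lemma trace_limit:
  fixes R V :: "nat \<Rightarrow> 'a set"
  assumes fin: "\<And>k. finite (V k)" and mono: "mono V"
  obtains P where "P \<subseteq> (\<Union>k. V k)" "\<And>k. \<exists>m\<ge>k. R m \<inter> V k = P \<inter> V k"
proof -
  let ?E = "\<lambda>k Q. Q \<subseteq> V k \<and> infinite {m. R m \<inter> V k = Q}"
  have "\<exists>Q. \<forall>k. ?E k (Q k) \<and> Q (Suc k) \<inter> V k = Q k"
  \<comment> \<open>Infinite recurrence is the invariant that lets the choice continue; the relation
    between successive choices is coherence.\<close>
  proof (rule dependent_nat_choice)
    show "\<exists>Q. ?E 0 Q"
      using infinite_trace[OF infinite_UNIV_nat fin, where R = R] by simp blast
  next
    fix Q k assume Q: "?E k Q"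
    \<comment> \<open>Pigeonhole is applied only to indices already realizing \<open>Q\<close> on
      \<open>V k\<close>, which forces the new trace to restrict to \<open>Q\<close>.\<close>
    then obtain Q' where Q': "Q' \<subseteq> V (Suc k)"
      "infinite {m \<in> {m. R m \<inter> V k = Q}. R m \<inter> V (Suc k) = Q'}" (is "infinite ?M")
      using infinite_trace[OF _ fin] by blast
    have "?M \<noteq> {}" using Q'(2) by (rule infinite_imp_nonempty)
    then obtain m where m: "R m \<inter> V k = Q" "R m \<inter> V (Suc k) = Q'" by blast
    have "V k \<subseteq> V (Suc k)" using mono by (simp add: monoD)
    with m have "Q' \<inter> V k = Q" by blast
    moreover have "infinite {m. R m \<inter> V (Suc k) = Q'}"
      by (rule infinite_super[OF _ Q'(2)]) blast
    ultimately show "\<exists>Q'. ?E (Suc k) Q' \<and> Q' \<inter> V k = Q" using Q'(1) by blast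
  qed
  then obtain Q where Q: "\<And>k. Q k \<subseteq> V k" "\<And>k. infinite {m. R m \<inter> V k = Q k}"
    and step: "\<And>k. Q (Suc k) \<inter> V k = Q k" by blast
  have coherent: "Q j \<inter> V k = Q k" if "k \<le> j" for j k
    using that
  proof (induction j rule: dec_induct)
    case base
    then show ?case using Q(1) by blast
  next
    case (step j)
    have "V k \<subseteq> V j" using step.hyps mono by (simp add: monoD)
    with step.IH \<open>\<And>k. Q (Suc k) \<inter> V k = Q k\<close>[of j] show ?case by blast
  qed
  have "(\<Union>j. Q j) \<inter> V k = Q k" for k
  proof
    show "Q k \<subseteq> (\<Union>j. Q j) \<inter> V k" using Q(1) by blast
    show "(\<Union>j. Q j) \<inter> V k \<subseteq> Q k"
    proof
      fix x assume "x \<in> (\<Union>j. Q j) \<inter> V k"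
      then obtain j where j: "x \<in> Q j" "x \<in> V k" by blast
      \<comment> \<open>Whichever of \<open>j\<close> and \<open>k\<close> is larger, coherence
        makes the trace at the smaller index a restriction of the other.\<close>
      show "x \<in> Q k"
        using j coherent[of k j] coherent[of j k] by (cases "k \<le> j") auto
    qed
  qed
  \<comment> \<open>An infinite set of natural numbers is unbounded, so it has a member
    \<open>m \<ge> k\<close>.\<close>
  moreover have "\<exists>m\<ge>k. R m \<inter> V k = Q k" for k
    using Q(2)[of k] unfolding finite_nat_set_iff_bounded_le by (meson mem_Collect_eq nat_le_linear)
  ultimately show ?thesis using Q(1) by (intro that[of "\<Union>j. Q j"]) auto
qed

section \<open>Balls and elementwise forms of the cone axioms\<close>

lemma finite_W: "finite (W n k)"
proof (rule finite_subset)
  show "W n k \<subseteq> {w. set w \<subseteq> {1..n} \<times> UNIV \<and> length w \<le> k}"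
    by (fastforce simp: W_def free_group_simps)
qed (simp add: finite_lists_length_le)

lemma mono_W: "mono (W n)"
  by (auto simp: W_def mono_def)

lemma braid_action_auto:
  "\<beta> \<in> carrier (braid_group n) \<Longrightarrow> braid_action n \<beta> \<in> auto (Fn n)"
  using braid_action_hom by (auto simp: hom_def AutoGroup_simps)

lemma set_inv_iff:
  assumes "group G" "P \<subseteq> carrier G" "x \<in> carrier G"
  shows "x \<in> set_inv\<^bsub>G\<^esub> P \<longleftrightarrow> inv\<^bsub>G\<^esub> x \<in> P"
proof -
  interpret group G by fact
  show ?thesis
    using assms(2,3) by (force simp: SET_INV_def)
qed

lemma W_carrier: "W n k \<subseteq> carrier (Fn n)"
  by (auto simp: W_def)

text \<open>Unfolds set products, cosets and \<open>set_inv\<close> into conditions on single words,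
  the form in which they pass from a precone to the limit.\<close>

lemma preconeD:
  assumes "precone n k P"
  shows "P \<subseteq> W n k" "\<one>\<^bsub>Fn n\<^esub> \<notin> P"
    "\<And>x. x \<in> W n k \<Longrightarrow> x = \<one>\<^bsub>Fn n\<^esub> \<or> x \<in> P \<or> inv\<^bsub>Fn n\<^esub> x \<in> P"
    "\<And>x. x \<in> P \<Longrightarrow> inv\<^bsub>Fn n\<^esub> x \<notin> P"
    "\<And>x y. x \<in> P \<Longrightarrow> y \<in> P \<Longrightarrow> x \<otimes>\<^bsub>Fn n\<^esub> y \<in> W n k \<Longrightarrow> x \<otimes>\<^bsub>Fn n\<^esub> y \<in> P"
    "\<And>g x. g \<in> W n k \<Longrightarrow> x \<in> P \<Longrightarrow> g \<otimes>\<^bsub>Fn n\<^esub> x \<otimes>\<^bsub>Fn n\<^esub> inv\<^bsub>Fn n\<^esub> g \<in> W n k \<Longrightarrow>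
       g \<otimes>\<^bsub>Fn n\<^esub> x \<otimes>\<^bsub>Fn n\<^esub> inv\<^bsub>Fn n\<^esub> g \<in> P"
proof -
  show P: "P \<subseteq> W n k" and "\<one>\<^bsub>Fn n\<^esub> \<notin> P"
    using assms unfolding precone_def by blast+
  have inv: "x \<in> set_inv\<^bsub>Fn n\<^esub> P \<longleftrightarrow> inv\<^bsub>Fn n\<^esub> x \<in> P" if "x \<in> W n k" for x
    using P that W_carrier[of n k] by (intro set_inv_iff[OF group_free_group]) auto
  show "x = \<one>\<^bsub>Fn n\<^esub> \<or> x \<in> P \<or> inv\<^bsub>Fn n\<^esub> x \<in> P" if "x \<in> W n k" for x
    using assms inv[OF that] that unfolding precone_def by blast
  show "inv\<^bsub>Fn n\<^esub> x \<notin> P" if "x \<in> P" for x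
    using assms inv[of x] that P unfolding precone_def by blast
  show "x \<otimes>\<^bsub>Fn n\<^esub> y \<in> P" if "x \<in> P" "y \<in> P" "x \<otimes>\<^bsub>Fn n\<^esub> y \<in> W n k" for x y
    using assms that unfolding precone_def set_mult_def by blast
  show "g \<otimes>\<^bsub>Fn n\<^esub> x \<otimes>\<^bsub>Fn n\<^esub> inv\<^bsub>Fn n\<^esub> g \<in> P"
    if "g \<in> W n k" "x \<in> P" "g \<otimes>\<^bsub>Fn n\<^esub> x \<otimes>\<^bsub>Fn n\<^esub> inv\<^bsub>Fn n\<^esub> g \<in> W n k" for g x
    using assms that unfolding precone_def l_coset_def r_coset_def by blast
qed

text \<open>Closure under conjugation suffices for the equality of \<open>P\<close> with its
  conjugates: the reverse inclusion comes from conjugating by the inverse of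
  \<open>g\<close>.\<close>

lemma positive_coneI:
  assumes P: "P \<subseteq> carrier (Fn n)" and one: "\<one>\<^bsub>Fn n\<^esub> \<notin> P"
    and total: "\<And>x. x \<in> carrier (Fn n) \<Longrightarrow> x = \<one>\<^bsub>Fn n\<^esub> \<or> x \<in> P \<or> inv\<^bsub>Fn n\<^esub> x \<in> P"
    and asym: "\<And>x. x \<in> P \<Longrightarrow> inv\<^bsub>Fn n\<^esub> x \<notin> P"
    and mult: "\<And>x y. x \<in> P \<Longrightarrow> y \<in> P \<Longrightarrow> x \<otimes>\<^bsub>Fn n\<^esub> y \<in> P"
    and conj: "\<And>g x. g \<in> carrier (Fn n) \<Longrightarrow> x \<in> P \<Longrightarrow> g \<otimes>\<^bsub>Fn n\<^esub> x \<otimes>\<^bsub>Fn n\<^esub> inv\<^bsub>Fn n\<^esub> g \<in> P"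
  shows "positive_cone n P"
proof -
  interpret group "Fn n" by (rule group_free_group)
  have inv: "x \<in> set_inv\<^bsub>Fn n\<^esub> P \<longleftrightarrow> inv\<^bsub>Fn n\<^esub> x \<in> P" if "x \<in> carrier (Fn n)" for x
    using set_inv_iff[OF group_free_group P that] .
  have "set_inv\<^bsub>Fn n\<^esub> P \<subseteq> carrier (Fn n)"
    using P by (auto simp: SET_INV_def)
  then have "carrier (Fn n) = P \<union> set_inv\<^bsub>Fn n\<^esub> P \<union> {\<one>\<^bsub>Fn n\<^esub>}"
    using P total inv one_closed by blast
  moreover have "P \<inter> set_inv\<^bsub>Fn n\<^esub> P = {}"
    using P asym inv by blast
  moreover have "\<one>\<^bsub>Fn n\<^esub> \<notin> set_inv\<^bsub>Fn n\<^esub> P"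
    using inv[OF one_closed] one by simp
  moreover have "P <#>\<^bsub>Fn n\<^esub> P \<subseteq> P"
    using mult by (auto simp: set_mult_def)
  moreover have "g <#\<^bsub>Fn n\<^esub> P #>\<^bsub>Fn n\<^esub> inv\<^bsub>Fn n\<^esub> g = P" if g: "g \<in> carrier (Fn n)" for g
  proof
    show "g <#\<^bsub>Fn n\<^esub> P #>\<^bsub>Fn n\<^esub> inv\<^bsub>Fn n\<^esub> g \<subseteq> P"
      using conj[OF g] by (auto simp: l_coset_def r_coset_def)
    show "P \<subseteq> g <#\<^bsub>Fn n\<^esub> P #>\<^bsub>Fn n\<^esub> inv\<^bsub>Fn n\<^esub> g"
    proof
      fix x assume x: "x \<in> P"
      then have xc: "x \<in> carrier (Fn n)" using P by blast
      define y where "y = inv\<^bsub>Fn n\<^esub> g \<otimes>\<^bsub>Fn n\<^esub> x \<otimes>\<^bsub>Fn n\<^esub> g"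
      have "y \<in> P" using conj[of "inv\<^bsub>Fn n\<^esub> g"] g x by (simp add: y_def)
      moreover have "x = g \<otimes>\<^bsub>Fn n\<^esub> y \<otimes>\<^bsub>Fn n\<^esub> inv\<^bsub>Fn n\<^esub> g"
      proof -
        have "g \<otimes>\<^bsub>Fn n\<^esub> y = x \<otimes>\<^bsub>Fn n\<^esub> g"
          using g xc by (simp add: y_def m_assoc[symmetric])
        then show ?thesis using g xc by (simp add: m_assoc)
      qed
      ultimately show "x \<in> g <#\<^bsub>Fn n\<^esub> P #>\<^bsub>Fn n\<^esub> inv\<^bsub>Fn n\<^esub> g"
        by (auto simp: l_coset_def r_coset_def)
    qed
  qed
  ultimately show ?thesis using one unfolding positive_cone_def by blast
qed

section \<open>Limits of preserved precones\<close>

lemma in_common_W: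
  assumes "finite A" "A \<subseteq> carrier (Fn n)"
  obtains k where "A \<subseteq> W n k"
proof
  show "A \<subseteq> W n (\<Sum>w\<in>A. length w)"
    using assms by (auto simp: W_def intro: member_le_sum)
qed

text \<open>Each axiom is checked on a finite set containing the given words and the word to be
  placed in \<open>P\<close>. On that set \<open>P\<close> agrees with a precone whose ball contains
  it, so truncation to the ball loses nothing.\<close>

lemma order_preserving_limit:
  assumes \<beta>: "\<beta> \<in> carrier (braid_group n)"
    and P: "P \<subseteq> carrier (Fn n)"
    and approx: "\<And>k. \<exists>m\<ge>k. \<exists>R\<in>preserved_precones n \<beta> m. R \<inter> W n k = P \<inter> W n k"
  shows "order_preserving n \<beta>"
proof -
  interpret group "Fn n" by (rule group_free_group)
  let ?f = "braid_action n \<beta>"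
  have auto: "?f \<in> auto (Fn n)" using \<beta> by (rule braid_action_auto)
  interpret f: group_hom "Fn n" "Fn n" ?f
    using auto by (simp add: group_hom_def group_hom_axioms_def group_free_group auto_def)
  have f_onto: "?f ` carrier (Fn n) = carrier (Fn n)"
    using auto by (auto simp: auto_def Bij_def bij_betw_def)
  \<comment> \<open>Agreement holds on the ball of radius \<open>k\<close> around \<open>A\<close>'s
    words, while the precone lives at stage \<open>m\<close>; \<open>m \<ge> k\<close> puts
    \<open>A\<close> in both balls.\<close>
  have local: "\<exists>m R. precone n m R \<and> preserved n \<beta> m R \<and> A \<subseteq> W n m \<and> (\<forall>x\<in>A. x \<in> R \<longleftrightarrow> x \<in> P)"
    if A: "finite A" "A \<subseteq> carrier (Fn n)" for A
  proof -
    obtain k where k: "A \<subseteq> W n k" using A by (rule in_common_W)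
    obtain m R where "m \<ge> k" "R \<in> preserved_precones n \<beta> m" "R \<inter> W n k = P \<inter> W n k"
      using approx by blast
    moreover have "W n k \<subseteq> W n m" using \<open>m \<ge> k\<close> mono_W by (rule monoD[rotated])
    ultimately show ?thesis
      using k unfolding preserved_precones_def by blast
  qed
  have asym: "inv\<^bsub>Fn n\<^esub> x \<notin> P" if x: "x \<in> P" for x
  proof -
    obtain m R where "precone n m R" "x \<in> R" "inv\<^bsub>Fn n\<^esub> x \<in> R \<longleftrightarrow> inv\<^bsub>Fn n\<^esub> x \<in> P"
      using local[of "{x, inv\<^bsub>Fn n\<^esub> x}"] x P by auto
    then show ?thesis using preconeD(4) by blast
  qed
  have one: "\<one>\<^bsub>Fn n\<^esub> \<notin> P"
    using local[of "{\<one>\<^bsub>Fn n\<^esub>}"] preconeD(2) by auto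
  have total: "x = \<one>\<^bsub>Fn n\<^esub> \<or> x \<in> P \<or> inv\<^bsub>Fn n\<^esub> x \<in> P" if "x \<in> carrier (Fn n)" for x
    using that local[of "{x, inv\<^bsub>Fn n\<^esub> x}"] preconeD(3) by simp blast
  have cone: "positive_cone n P"
  proof (rule positive_coneI[OF P one total])
    show "\<And>x. x \<in> P \<Longrightarrow> inv\<^bsub>Fn n\<^esub> x \<notin> P" by (rule asym)
  next
    fix x y assume xy: "x \<in> P" "y \<in> P"
    then obtain m R where "precone n m R" "x \<in> R" "y \<in> R" "x \<otimes>\<^bsub>Fn n\<^esub> y \<in> W n m"
      "x \<otimes>\<^bsub>Fn n\<^esub> y \<in> R \<longleftrightarrow> x \<otimes>\<^bsub>Fn n\<^esub> y \<in> P"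
      using local[of "{x, y, x \<otimes>\<^bsub>Fn n\<^esub> y}"] P by auto
    then show "x \<otimes>\<^bsub>Fn n\<^esub> y \<in> P" using preconeD(5) by blast
  next
    fix g x assume g: "g \<in> carrier (Fn n)" and x: "x \<in> P"
    let ?c = "g \<otimes>\<^bsub>Fn n\<^esub> x \<otimes>\<^bsub>Fn n\<^esub> inv\<^bsub>Fn n\<^esub> g"
    \<comment> \<open>The conjugator is included because a precone is closed only under conjugation
      by words of its own ball.\<close>
    have "{g, x, ?c} \<subseteq> carrier (Fn n)" using g x P by auto
    then obtain m R where "precone n m R" "g \<in> W n m" "x \<in> R" "?c \<in> W n m" "?c \<in> R \<longleftrightarrow> ?c \<in> P"
      using local[of "{g, x, ?c}"] x by auto
    then show "?c \<in> P" using preconeD(6) by blast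
  qed
  have into: "?f x \<in> P" if x: "x \<in> P" for x
  proof -
    have "{x, ?f x} \<subseteq> carrier (Fn n)" using x P f.hom_closed by blast
    then obtain m R where "preserved n \<beta> m R" "x \<in> R" "?f x \<in> W n m" "?f x \<in> R \<longleftrightarrow> ?f x \<in> P"
      using local[of "{x, ?f x}"] x by auto
    then show ?thesis unfolding preserved_def by blast
  qed
  \<comment> \<open>\<open>preserved\<close> gives only the forward inclusion. For the reverse, a
    preimage \<open>y\<close> of \<open>x\<close> outside \<open>P\<close> would be trivial or have
    its inverse in \<open>P\<close>; applying the automorphism then contradicts
    \<open>x \<in> P\<close>.\<close>
  have "P \<subseteq> ?f ` P"
  proof
    fix x assume x: "x \<in> P"
    then have "x \<in> ?f ` carrier (Fn n)" unfolding f_onto using P by blast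
    then obtain y where y: "y \<in> carrier (Fn n)" "?f y = x" by blast
    have "y \<noteq> \<one>\<^bsub>Fn n\<^esub>"
      using x y(2) one f.hom_one by fastforce
    moreover have "inv\<^bsub>Fn n\<^esub> y \<notin> P"
    proof
      assume "inv\<^bsub>Fn n\<^esub> y \<in> P"
      then have "inv\<^bsub>Fn n\<^esub> x \<in> P" using into[of "inv\<^bsub>Fn n\<^esub> y"] y f.hom_inv by simp
      with x show False using asym by blast
    qed
    ultimately have "y \<in> P" using y total by blast
    then show "x \<in> ?f ` P" using y by blast
  qed
  then show ?thesis using cone into unfolding order_preserving_def by blast
qed

section \<open>Termination of the search\<close>

text \<open>One empty stage makes the loop test fail there at the latest; the stage returned may be
  an earlier one.\<close>

lemma precone_search_stops:
  assumes "preserved_precones n \<beta> k = {}" "k \<ge> 1"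
  shows "\<exists>k. precone_search n \<beta> = Some (k, {})"
proof -
  let ?b = "\<lambda>(k, Ps). Ps \<noteq> {}"
  let ?c = "\<lambda>(k, Ps). (k + 1, preserved_precones n \<beta> (k + 1))"
  let ?s = "(1, preserved_precones n \<beta> 1)"
  have iter: "(?c ^^ j) ?s = (Suc j, preserved_precones n \<beta> (Suc j))" for j
    by (induction j) (simp_all add: One_nat_def)
  \<comment> \<open>The loop starts at stage 1, so stage \<open>k\<close> is reached after
    \<open>k - 1\<close> iterations.\<close>
  have "\<not> ?b ((?c ^^ (k - 1)) ?s)" unfolding iter using assms by simp
  then have "\<exists>j. \<not> ?b ((?c ^^ j) ?s)" by (rule exI)
  then have "precone_search n \<beta> \<noteq> None"
    by (simp only: precone_search_def while_option_def if_True option.simps not_False_eq_True)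
  then obtain l Ps where "precone_search n \<beta> = Some (l, Ps)" by auto
  moreover from this have "Ps = {}"
    using while_option_stop unfolding precone_search_def by fastforce
  ultimately show ?thesis by blast
qed

theorem theorem4:
  fixes n :: nat and \<beta> :: "nat word set"
  assumes "\<beta> \<in> carrier (braid_group n)"
    and "\<not> order_preserving n \<beta>"
  shows "\<exists>k. precone_search n \<beta> = Some (k, {}) \<and> (\<forall>j\<in>{1..k}. finite (Pow (W n j)))"
proof -
  have "\<exists>k\<ge>1. preserved_precones n \<beta> k = {}"
  proof (rule ccontr)
    assume "\<not> ?thesis"
    then have "\<forall>m. \<exists>S. m \<ge> 1 \<longrightarrow> S \<in> preserved_precones n \<beta> m" by blast
    then obtain R where R: "\<And>m. m \<ge> 1 \<Longrightarrow> R m \<in> preserved_precones n \<beta> m"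
      by metis
    \<comment> \<open>Stages start at 1 but \<open>trace_limit\<close> indexes from 0, so both balls
      and precones are shifted by \<open>Suc\<close>.\<close>
    have "mono (\<lambda>k. W n (Suc k))" by (auto simp: W_def mono_def)
    then obtain P where P: "P \<subseteq> (\<Union>k. W n (Suc k))"
      and agree: "\<And>k. \<exists>m\<ge>k. R (Suc m) \<inter> W n (Suc k) = P \<inter> W n (Suc k)"
      using trace_limit[of "\<lambda>k. W n (Suc k)" "\<lambda>m. R (Suc m)"] finite_W by metis
    have "order_preserving n \<beta>"
    proof (rule order_preserving_limit[OF assms(1)])
      show "P \<subseteq> carrier (Fn n)" using P W_carrier by blast
      fix k
      obtain m where m: "m \<ge> k" "R (Suc m) \<inter> W n (Suc k) = P \<inter> W n (Suc k)"
        using agree by blast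
      \<comment> \<open>Undoes the shift: agreement on the larger ball restricts to the ball of
        radius \<open>k\<close>.\<close>
      moreover have "W n k \<subseteq> W n (Suc k)" using mono_W by (simp add: monoD)
      ultimately have "Suc m \<ge> k" "R (Suc m) \<inter> W n k = P \<inter> W n k" by auto
      then show "\<exists>m\<ge>k. \<exists>R\<in>preserved_precones n \<beta> m. R \<inter> W n k = P \<inter> W n k"
        using R[of "Suc m"] by auto
    qed
    with assms(2) show False by blast
  qed
  then show ?thesis using precone_search_stops finite_W by blast
qed

end
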